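(* Let $n\ge4$ and let $S$ be an inductive strategy of length $n$ with $S[n]\neq[2,3,\dots,n,1]$ (i.e. $S\neq CS$). Then the number of permutations $\pi\in S_n$ such that the game with strategy $S$ and secret $\pi$ ends after exactly three guesses and $\rho_S(\pi)=2$ is strictly less than $2^n-2n-2$.
   Context: Permutation wordle on $[n]=\{1,\dots,n\}$: a secret permutation $\pi\in S_n$ (one-line notation) is fixed. The first guess is $\gamma_1=[1,2,\dots,n]$. After guess $\gamma_r$ the guesser learns $\mathcal{J}_r=\{i:\gamma_r(i)=\pi(i)\}$; $\mathcal{I}_r=[n]\setminus\mathcal{J}_r$. The game ends at the first $r$ with $\mathcal{J}_r=[n]$. A strategy of length $n$ is a sequence $S=(S[1],\dots,S[n])$ with $S[k]$ a permutation of $[k]$; if $\mathcal{I}_r=\{i_1<\dots<i_k\}\neq\emptyset$ and $\sigma=S[k]$, then $\gamma_{r+1}(i)=\gamma_r(i)$ for $i\in\mathcal{J}_r$ and $\gamma_{r+1}(i_{\sigma(j)})=\gamma_r(i_j)$ for $j=1,\dots,k$. The cyclic shift strategy $CS$ has $CS[k]=[2,3,\dots,k,1]$. An inductive strategy of length $n$ has $S[k]=CS[k]$ for $1\le k\le n-1$ and $S[n]$ an arbitrary cyclic permutation (single $n$-cycle) of $[n]$. For a secret $\pi$, $\rho_S(\pi)=\min\{i:\mathcal{J}_i\neq\emptyset\}$. *)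

theory Defs
  imports "HOL-Combinatorics.Combinatorics"
begin

text \<open>
  A permutation of [k] is a function \<open>nat \<Rightarrow> nat\<close> satisfying \<open>permutes {1..k}\<close>
  (so it is the identity outside \<open>{1..k}\<close>), with \<open>\<sigma> i\<close> the i-th entry of its one-line
  notation.  Guesses are numbered from 1.
\<close>

definition cyclic_shift :: "nat \<Rightarrow> nat \<Rightarrow> nat" where
  "cyclic_shift k i = (if i \<in> {1..k} then (if i = k then 1 else i + 1) else i)"

text \<open>Only the values \<open>S 1, \<dots>, S n\<close> of a strategy of length n are meaningful.\<close>

definition is_strategy :: "nat \<Rightarrow> (nat \<Rightarrow> nat \<Rightarrow> nat) \<Rightarrow> bool" where
  "is_strategy n S \<longleftrightarrow> (\<forall>k\<in>{1..n}. S k permutes {1..k})"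

definition inductive_strategy :: "nat \<Rightarrow> (nat \<Rightarrow> nat \<Rightarrow> nat) \<Rightarrow> bool" where
  "inductive_strategy n S \<longleftrightarrow>
     is_strategy n S \<and> (\<forall>k\<in>{1..<n}. S k = cyclic_shift k) \<and> cyclic_on (S n) {1..n}"

definition correct_positions :: "nat \<Rightarrow> (nat \<Rightarrow> nat) \<Rightarrow> (nat \<Rightarrow> nat) \<Rightarrow> nat set" where
  "correct_positions n \<pi> \<gamma> = {i \<in> {1..n}. \<gamma> i = \<pi> i}"

text \<open>\<open>nth_smallest I j\<close> is \<open>i\<^sub>j\<close> where \<open>I = {i\<^sub>1 < \<dots> < i\<^sub>k}\<close>; it is meant for \<open>1 \<le> j \<le> k\<close>.\<close>

definition nth_smallest :: "nat set \<Rightarrow> nat \<Rightarrow> nat" where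
  "nth_smallest I j = sorted_list_of_set I ! (j - 1)"

text \<open>
  At an incorrect position \<open>i\<close> the new guess is \<open>\<gamma> i\<^sub>j\<close> for the \<open>j \<in> {1..k}\<close> with
  \<open>i = i\<^bsub>\<sigma> j\<^esub>\<close>; the lemma \<open>next_guess_incorrect\<close> below is the rule in its usual form.
\<close>

definition next_guess ::
    "nat \<Rightarrow> (nat \<Rightarrow> nat \<Rightarrow> nat) \<Rightarrow> (nat \<Rightarrow> nat) \<Rightarrow> (nat \<Rightarrow> nat) \<Rightarrow> nat \<Rightarrow> nat" where
  "next_guess n S \<pi> \<gamma> =
     (let I = {1..n} - correct_positions n \<pi> \<gamma>; k = card I; \<sigma> = S k in
      (\<lambda>i. if i \<in> I
           then \<gamma> (nth_smallest I (inv_into {1..k} (\<lambda>j. nth_smallest I (\<sigma> j)) i))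
           else \<gamma> i))"

lemma next_guess_correct:
  assumes "i \<in> correct_positions n \<pi> \<gamma>"
  shows "next_guess n S \<pi> \<gamma> i = \<gamma> i"
  using assms by (simp add: next_guess_def Let_def)

lemma bij_betw_nth_smallest:
  assumes "finite I"
  shows "bij_betw (nth_smallest I) {1..card I} I"
proof -
  have "bij_betw (\<lambda>j. j - 1) {1..card I} {..<card I}"
    by (rule bij_betw_byWitness[where f' = Suc]) auto
  moreover have "bij_betw (\<lambda>j. sorted_list_of_set I ! j) {..<card I} I"
    using assms by (intro bij_betw_nth) auto
  ultimately show ?thesis
    using bij_betw_trans unfolding nth_smallest_def comp_def by fastforce
qed

lemma nth_smallest_strict_mono:
  assumes "finite I"
  shows "strict_mono_on {1..card I} (nth_smallest I)"
proof (rule strict_mono_onI)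
  fix r s assume rs: "r \<in> {1..card I}" "s \<in> {1..card I}" "r < s"
  then have "r - 1 < s - 1" "s - 1 < length (sorted_list_of_set I)" by auto
  then show "nth_smallest I r < nth_smallest I s"
    unfolding nth_smallest_def
    using strict_sorted_list_of_set[of I] by (simp add: sorted_wrt_nth_less)
qed

lemma next_guess_incorrect:
  assumes "is_strategy n S"
    and "I = {1..n} - correct_positions n \<pi> \<gamma>" and "j \<in> {1..card I}"
  shows "next_guess n S \<pi> \<gamma> (nth_smallest I (S (card I) j)) = \<gamma> (nth_smallest I j)"
proof -
  have fin: "finite I" using assms(2) by simp
  have "card I \<le> n" using assms(2) card_mono[of "{1..n}" I] by simp
  then have perm: "S (card I) permutes {1..card I}"
    using assms(1,3) by (auto simp: is_strategy_def)
  have bij: "bij_betw (\<lambda>j. nth_smallest I (S (card I) j)) {1..card I} I"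
    using bij_betw_trans[OF permutes_imp_bij[OF perm] bij_betw_nth_smallest[OF fin]]
    by (simp add: comp_def)
  have "nth_smallest I (S (card I) j) \<in> I"
    using bij assms(3) by (auto simp: bij_betw_def)
  then show ?thesis
    using bij_betw_inv_into_left[OF bij assms(3)] assms(2)
    by (simp add: next_guess_def Let_def)
qed

text \<open>The r-th guess, for \<open>r \<ge> 1\<close>; the value at \<open>r = 0\<close> is a dummy.  Once a guess equals
  the secret, it is repeated forever.\<close>

definition guess :: "nat \<Rightarrow> (nat \<Rightarrow> nat \<Rightarrow> nat) \<Rightarrow> (nat \<Rightarrow> nat) \<Rightarrow> nat \<Rightarrow> nat \<Rightarrow> nat" where
  "guess n S \<pi> r = (next_guess n S \<pi> ^^ (r - 1)) id"

definition correct_at :: "nat \<Rightarrow> (nat \<Rightarrow> nat \<Rightarrow> nat) \<Rightarrow> (nat \<Rightarrow> nat) \<Rightarrow> nat \<Rightarrow> nat set" where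
  "correct_at n S \<pi> r = correct_positions n \<pi> (guess n S \<pi> r)"

definition ends_after :: "nat \<Rightarrow> (nat \<Rightarrow> nat \<Rightarrow> nat) \<Rightarrow> (nat \<Rightarrow> nat) \<Rightarrow> nat \<Rightarrow> bool" where
  "ends_after n S \<pi> r \<longleftrightarrow>
     r \<ge> 1 \<and> correct_at n S \<pi> r = {1..n} \<and> (\<forall>s\<in>{1..<r}. correct_at n S \<pi> s \<noteq> {1..n})"

definition rho :: "nat \<Rightarrow> (nat \<Rightarrow> nat \<Rightarrow> nat) \<Rightarrow> (nat \<Rightarrow> nat) \<Rightarrow> nat" where
  "rho n S \<pi> = (LEAST r. r \<ge> 1 \<and> correct_at n S \<pi> r \<noteq> {})"

end

theory Submission
  imports Defs
begin

text \<open>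
  Let \<open>\<sigma> = S n\<close>. If \<open>\<rho> = 2\<close> and the game ends after three guesses, the second guess is
  \<open>inv \<sigma>\<close>, and the secret is determined by the set \<open>I\<close> of positions that it gets wrong, since the
  third guess depends on \<open>I\<close> only. So it suffices to find \<open>2 n + 3\<close> subsets of \<open>{1..n}\<close> which
  are not such a set \<open>I\<close>. The secret has no fixed point, which forbids that \<open>\<sigma> y\<close> is the cyclic
  predecessor of \<open>y\<close> in \<open>I\<close> for some \<open>y \<in> I\<close>. Hence \<open>I\<close> is none of the \<open>n\<close> pairs \<open>{y, \<sigma> y}\<close>,
  and it is not empty, not a singleton, and not \<open>{1..n}\<close>. If \<open>\<sigma>\<close> and the cyclic
  shift differ at \<open>y\<close>, there is room for a third element beside \<open>y\<close> and \<open>\<sigma> y\<close>, between them if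
  \<open>y < \<sigma> y\<close> and outside otherwise, so that \<open>\<sigma> y\<close> is still the cyclic predecessor of \<open>y\<close>.
\<close>

section \<open>Cyclic successors in small sets, and short cycles\<close>

definition cyclic_succ :: "nat set \<Rightarrow> nat \<Rightarrow> nat \<Rightarrow> bool" where
  "cyclic_succ I x y \<longleftrightarrow>
     (\<exists>j\<in>{1..card I}. nth_smallest I j = x \<and> nth_smallest I (cyclic_shift (card I) j) = y)"

lemma cyclic_succ_singleton: "cyclic_succ {x} x x"
  by (auto simp: cyclic_succ_def nth_smallest_def cyclic_shift_def)

lemma cyclic_succ_pair:
  assumes "x \<noteq> y"
  shows "cyclic_succ {x, y} x y"
proof (cases "x < y")
  case True
  then show ?thesis
    by (auto simp: cyclic_succ_def nth_smallest_def cyclic_shift_def intro!: bexI[of _ 1])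
next
  case False
  with assms show ?thesis
    by (auto simp: cyclic_succ_def nth_smallest_def cyclic_shift_def intro!: bexI[of _ 2])
qed

lemma cyclic_succ_triple:
  assumes "a < b" "b < c"
  shows "cyclic_succ {a, b, c} a b" "cyclic_succ {a, b, c} b c" "cyclic_succ {a, b, c} c a"
proof -
  have *: "card {a, b, c} = 3" "sorted_list_of_set {a, b, c} = [a, b, c]"
    using assms by auto
  show "cyclic_succ {a, b, c} a b"
    unfolding cyclic_succ_def nth_smallest_def * by (rule bexI[of _ 1]) (auto simp: cyclic_shift_def)
  show "cyclic_succ {a, b, c} b c"
    unfolding cyclic_succ_def nth_smallest_def * by (rule bexI[of _ 2]) (auto simp: cyclic_shift_def)
  show "cyclic_succ {a, b, c} c a"
    unfolding cyclic_succ_def nth_smallest_def * by (rule bexI[of _ 3]) (auto simp: cyclic_shift_def)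
qed

text \<open>The orbit of \<open>x\<close> closes up within \<open>{x, f x}\<close> and is all of
  \<open>A\<close>. For \<open>n \<ge> 4\<close> this rules out both fixed points and 2-cycles of
  \<open>S n\<close>.\<close>

lemma cyclic_on_card_le_2:
  assumes "cyclic_on f A" "x \<in> A" "f (f x) = x"
  shows "card A \<le> 2"
proof -
  have "y \<in> {x, f x}" if "y \<in> orbit f x" for y
    using that by induction (use assms(3) in auto)
  moreover have "A = orbit f x"
    using assms(1,2) by (simp add: orbit_cyclic_eq3)
  ultimately have "A \<subseteq> {x, f x}" by blast
  then have "card A \<le> card {x, f x}" by (intro card_mono) auto
  also have "\<dots> \<le> 2" by (simp add: card_insert_if)
  finally show ?thesis .
qed

section \<open>Feedback and the first guesses\<close>

lemma nth_smallest_atLeastAtMost: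
  assumes "j \<in> {1..n}"
  shows "nth_smallest {1..n} j = j"
proof -
  have "sorted_list_of_set {1..n} = [1..<Suc n]"
    by (metis atLeastLessThanSuc_atLeastAtMost sorted_list_of_set_range)
  then show ?thesis
    using assms by (simp add: nth_smallest_def del: upt_Suc)
qed

lemma next_guess_cong:
  assumes "correct_positions n \<pi> \<gamma> = correct_positions n \<pi>' \<gamma>"
  shows "next_guess n S \<pi> \<gamma> = next_guess n S \<pi>' \<gamma>"
  using assms by (simp add: next_guess_def)

lemma guess_1: "guess n S \<pi> 1 = id"
  by (simp add: guess_def)

lemma guess_Suc:
  assumes "r \<ge> 1"
  shows "guess n S \<pi> (Suc r) = next_guess n S \<pi> (guess n S \<pi> r)"
  using assms by (cases r) (auto simp: guess_def)

lemma correct_at_before_rho: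
  assumes "1 \<le> r" "r < rho n S \<pi>"
  shows "correct_at n S \<pi> r = {}"
  using not_less_Least[of r "\<lambda>r. r \<ge> 1 \<and> correct_at n S \<pi> r \<noteq> {}"] assms
  by (auto simp: rho_def)

text \<open>The \<open>LEAST\<close> in \<open>rho\<close> is known to be attained only if some
  guess has a correct position; \<open>r\<close> is the witness.\<close>

lemma correct_at_rho:
  assumes "1 \<le> r" "correct_at n S \<pi> r \<noteq> {}"
  shows "correct_at n S \<pi> (rho n S \<pi>) \<noteq> {}"
  using LeastI[of "\<lambda>r. r \<ge> 1 \<and> correct_at n S \<pi> r \<noteq> {}" r] assms
  by (auto simp: rho_def)

lemma guess_2_cong:
  assumes "correct_at n S \<pi> 1 = {}" "correct_at n S \<pi>' 1 = {}"
  shows "guess n S \<pi> 2 = guess n S \<pi>' 2"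
  using assms next_guess_cong[of n \<pi> id \<pi>' S] guess_Suc[of 1 n S]
  by (simp add: correct_at_def guess_1[simplified] numeral_2_eq_2)

text \<open>With every position wrong, ranks and positions coincide, so \<open>S n\<close> moves the
  entry \<open>j\<close> of the identity to position \<open>S n j\<close>.\<close>

lemma guess_2_apply:
  assumes "is_strategy n S" "correct_at n S \<pi> 1 = {}" "j \<in> {1..n}"
  shows "guess n S \<pi> 2 (S n j) = j"
proof -
  have c: "correct_positions n \<pi> id = {}"
    using assms(2) by (simp only: correct_at_def guess_1)
  have "S n permutes {1..n}" using assms(1,3) by (auto simp: is_strategy_def)
  then have "S n j \<in> {1..n}" using assms(3) by (simp only: permutes_in_image)
  moreover have "guess n S \<pi> 2 = next_guess n S \<pi> id"
    using guess_Suc[of 1 n S \<pi>] by (simp add: guess_1[simplified] numeral_2_eq_2)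
  ultimately show ?thesis
    using next_guess_incorrect[OF assms(1), of "{1..n}" \<pi> id j] c assms(3)
    by (simp add: nth_smallest_atLeastAtMost del: One_nat_def)
qed

section \<open>The counted secrets and their sets of wrong positions\<close>

definition wrong_at_2 :: "nat \<Rightarrow> (nat \<Rightarrow> nat \<Rightarrow> nat) \<Rightarrow> (nat \<Rightarrow> nat) \<Rightarrow> nat set" where
  "wrong_at_2 n S \<pi> = {1..n} - correct_at n S \<pi> 2"

definition three_guess_secrets :: "nat \<Rightarrow> (nat \<Rightarrow> nat \<Rightarrow> nat) \<Rightarrow> (nat \<Rightarrow> nat) set" where
  "three_guess_secrets n S = {\<pi>. \<pi> permutes {1..n} \<and> ends_after n S \<pi> 3 \<and> rho n S \<pi> = 2}"

context
  fixes n :: nat and S :: "nat \<Rightarrow> nat \<Rightarrow> nat" and \<pi> :: "nat \<Rightarrow> nat"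
  assumes secret: "\<pi> \<in> three_guess_secrets n S"
begin

lemma correct_at_1_secret: "correct_at n S \<pi> 1 = {}"
  using secret by (intro correct_at_before_rho) (auto simp: three_guess_secrets_def)

lemma guess_3_secret: "i \<in> {1..n} \<Longrightarrow> guess n S \<pi> 3 i = \<pi> i"
  using secret by (auto simp: three_guess_secrets_def ends_after_def correct_at_def correct_positions_def)

lemma wrong_at_2_nonempty: "wrong_at_2 n S \<pi> \<noteq> {}"
  using secret by (auto simp: three_guess_secrets_def ends_after_def wrong_at_2_def
      correct_at_def correct_positions_def)

lemma wrong_at_2_neq_all: "wrong_at_2 n S \<pi> \<noteq> {1..n}"
proof -
  have e: "correct_at n S \<pi> 3 = {1..n}" "correct_at n S \<pi> 2 \<noteq> {1..n}" "rho n S \<pi> = 2"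
    using secret by (auto simp: three_guess_secrets_def ends_after_def)
  moreover have "correct_at n S \<pi> 2 \<subseteq> {1..n}"
    by (auto simp: correct_at_def correct_positions_def)
  \<comment> \<open>\<open>{1..n}\<close> is nonempty because it properly contains the second
    correct set.\<close>
  ultimately have "correct_at n S \<pi> 3 \<noteq> {}" by auto
  then have "correct_at n S \<pi> 2 \<noteq> {}"
    using correct_at_rho[of 3 n S \<pi>] e by simp
  with \<open>correct_at n S \<pi> 2 \<subseteq> {1..n}\<close> show ?thesis
    by (auto simp: wrong_at_2_def)
qed

text \<open>The set of wrong positions is nonempty and proper, so the third guess comes from a
  cyclic shift: the entry at \<open>x\<close> moves to its successor \<open>y\<close>. That guess is
  the secret.\<close>

lemma secret_cyclic_succ:
  assumes "inductive_strategy n S" "cyclic_succ (wrong_at_2 n S \<pi>) x y"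
  shows "x \<in> {1..n}" "y \<in> wrong_at_2 n S \<pi>" "\<pi> y = guess n S \<pi> 2 x"
proof -
  let ?I = "wrong_at_2 n S \<pi>" and ?k = "card (wrong_at_2 n S \<pi>)"
  have strat: "is_strategy n S" using assms(1) by (simp add: inductive_strategy_def)
  have sub: "?I \<subseteq> {1..n}" by (auto simp: wrong_at_2_def)
  then have fin: "finite ?I" using finite_subset by blast
  have "?k < n" using psubset_card_mono[of "{1..n}" ?I] sub wrong_at_2_neq_all by auto
  moreover have "?k \<ge> 1" using wrong_at_2_nonempty fin by (simp add: Suc_leI card_gt_0_iff)
  ultimately have S: "S ?k = cyclic_shift ?k"
    using assms(1) by (auto simp: inductive_strategy_def)
  obtain j where j: "j \<in> {1..?k}" "nth_smallest ?I j = x"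
      "nth_smallest ?I (cyclic_shift ?k j) = y"
    using assms(2) by (auto simp: cyclic_succ_def)
  have "cyclic_shift ?k j \<in> {1..?k}" using j(1) by (auto simp: cyclic_shift_def)
  with j bij_betwE[OF bij_betw_nth_smallest[OF fin]] sub
  show "x \<in> {1..n}" and y: "y \<in> ?I" by blast+
  have "guess n S \<pi> 3 = next_guess n S \<pi> (guess n S \<pi> 2)"
    using guess_Suc[of 2 n S \<pi>] by (simp add: numeral_3_eq_3 numeral_2_eq_2)
  moreover have "?I = {1..n} - correct_positions n \<pi> (guess n S \<pi> 2)"
    by (simp add: wrong_at_2_def correct_at_def)
  ultimately have "guess n S \<pi> 3 y = guess n S \<pi> 2 x"
    using next_guess_incorrect[OF strat, of ?I \<pi> "guess n S \<pi> 2" j] j S by metis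
  with guess_3_secret[of y] y sub show "\<pi> y = guess n S \<pi> 2 x" by auto
qed

text \<open>An entry that stays at \<open>x\<close> would make \<open>x\<close> correct already in
  the second guess.\<close>

lemma not_cyclic_succ_refl:
  assumes "inductive_strategy n S"
  shows "\<not> cyclic_succ (wrong_at_2 n S \<pi>) x x"
  using secret_cyclic_succ[OF assms, of x x]
  by (auto simp: wrong_at_2_def correct_at_def correct_positions_def)

text \<open>The second guess has \<open>y\<close> at position \<open>S n y\<close>; shifting it to
  position \<open>y\<close> would give a fixed point of the secret, which the first guess would have
  revealed.\<close>

lemma not_cyclic_succ_image:
  assumes "inductive_strategy n S"
  shows "\<not> cyclic_succ (wrong_at_2 n S \<pi>) (S n y) y"
proof
  assume "cyclic_succ (wrong_at_2 n S \<pi>) (S n y) y"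
  note * = secret_cyclic_succ[OF assms this]
  then have "y \<in> {1..n}" by (auto simp: wrong_at_2_def)
  with * have "\<pi> y = y"
    using guess_2_apply[OF _ correct_at_1_secret] assms by (simp add: inductive_strategy_def)
  with \<open>y \<in> {1..n}\<close> correct_at_1_secret show False
    by (auto simp: correct_at_def correct_positions_def guess_1[simplified])
qed

end

lemma inj_on_wrong_at_2: "inj_on (wrong_at_2 n S) (three_guess_secrets n S)"
proof (rule inj_onI)
  fix \<pi> \<pi>' assume s: "\<pi> \<in> three_guess_secrets n S" "\<pi>' \<in> three_guess_secrets n S"
    and eq: "wrong_at_2 n S \<pi> = wrong_at_2 n S \<pi>'"
  have g: "guess n S \<pi> 2 = guess n S \<pi>' 2"
    using s by (intro guess_2_cong correct_at_1_secret)
  have "correct_at n S \<tau> 2 = {1..n} - wrong_at_2 n S \<tau>" for \<tau>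
    by (auto simp: wrong_at_2_def correct_at_def correct_positions_def)
  with eq have "correct_at n S \<pi> 2 = correct_at n S \<pi>' 2" by simp
  then have "next_guess n S \<pi> (guess n S \<pi> 2) = next_guess n S \<pi>' (guess n S \<pi>' 2)"
    unfolding correct_at_def g by (rule next_guess_cong)
  then have "guess n S \<pi> 3 = guess n S \<pi>' 3"
    using guess_Suc[of 2 n S] by (simp add: numeral_3_eq_3 numeral_2_eq_2)
  then have "\<pi> i = \<pi>' i" if "i \<in> {1..n}" for i
    using that s guess_3_secret by metis
  moreover have "\<pi> i = \<pi>' i" if "i \<notin> {1..n}" for i
    using that s unfolding three_guess_secrets_def
    by (metis (mono_tags, lifting) mem_Collect_eq permutes_not_in)
  ultimately show "\<pi> = \<pi>'" by (intro ext) blast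
qed

section \<open>The forbidden triple and the count\<close>

lemma exists_cyclic_succ_triple:
  assumes "n \<ge> 4" "\<sigma> permutes {1..n}" "\<forall>i\<in>{1..n}. \<sigma> i \<noteq> i" "\<sigma> \<noteq> cyclic_shift n"
  shows "\<exists>T y. T \<subseteq> {1..n} \<and> card T = 3 \<and> cyclic_succ T (\<sigma> y) y"
proof -
  obtain y where y: "\<sigma> y \<noteq> cyclic_shift n y" using assms(4) by blast
  have "y \<in> {1..n}"
    using y permutes_not_in[OF assms(2)] by (metis cyclic_shift_def)
  then have s: "\<sigma> y \<in> {1..n}" "\<sigma> y \<noteq> y"
    using assms(3) \<open>y \<in> {1..n}\<close> by (simp_all only: permutes_in_image[OF assms(2)] simp_thms)
  \<comment> \<open>The third element is \<open>y + 1\<close>, \<open>n\<close> or \<open>1\<close>,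
    respectively. If \<open>y < \<sigma> y\<close>, there is a gap since
    \<open>\<sigma> y \<noteq> y + 1\<close>; if \<open>y = n\<close>, then
    \<open>\<sigma> y \<noteq> 1\<close> leaves \<open>1\<close> free.\<close>
  consider "y + 1 < \<sigma> y" | "\<sigma> y < y" "y < n" | "\<sigma> y < y" "y = n" "1 < \<sigma> y"
    using y s \<open>y \<in> {1..n}\<close> unfolding cyclic_shift_def atLeastAtMost_iff
    by (cases "y = n"; cases "\<sigma> y < y") auto
  then show ?thesis
  proof cases
    case 1
    with s \<open>y \<in> {1..n}\<close> show ?thesis
      by (intro exI[of _ "{y, y + 1, \<sigma> y}"] exI[of _ y]) (auto intro: cyclic_succ_triple)
  next
    case 2
    with s show ?thesis
      by (intro exI[of _ "{\<sigma> y, y, n}"] exI[of _ y]) (auto intro: cyclic_succ_triple)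
  next
    case 3
    with s show ?thesis
      by (intro exI[of _ "{1, \<sigma> y, y}"] exI[of _ y]) (auto intro: cyclic_succ_triple)
  qed
qed

theorem theorem4p8:
  fixes n :: nat and S :: "nat \<Rightarrow> nat \<Rightarrow> nat"
  assumes "n \<ge> 4"
    and "inductive_strategy n S"
    and "S n \<noteq> cyclic_shift n"
  shows "int (card {\<pi>. \<pi> permutes {1..n} \<and> ends_after n S \<pi> 3 \<and> rho n S \<pi> = 2})
           < 2 ^ n - 2 * int n - 2"
proof -
  let ?\<sigma> = "S n"
  have cyc: "cyclic_on ?\<sigma> {1..n}" and perm: "?\<sigma> permutes {1..n}"
    using assms(1,2) by (auto simp: inductive_strategy_def is_strategy_def)
  have no2: "?\<sigma> (?\<sigma> i) \<noteq> i" if "i \<in> {1..n}" for i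
    using cyclic_on_card_le_2[OF cyc that] assms(1) by auto
  then have nofix: "?\<sigma> i \<noteq> i" if "i \<in> {1..n}" for i
    using that by metis
  obtain T y where T: "T \<subseteq> {1..n}" "card T = 3" "cyclic_succ T (?\<sigma> y) y"
    using exists_cyclic_succ_triple[OF assms(1) perm] nofix assms(3) by blast
  define P where "P = (\<lambda>i. {?\<sigma> i, i}) ` {1..n}"
  define Q where "Q = (\<lambda>i. {i}) ` {1..n}"
  define B where "B = {{}, {1..n}, T} \<union> (P \<union> Q)"
  \<comment> \<open>Equal pairs from distinct indices would form a 2-cycle of
    \<open>?\<sigma>\<close>.\<close>
  have "inj_on (\<lambda>i. {?\<sigma> i, i}) {1..n}"
    using no2 by (intro inj_onI) (metis doubleton_eq_iff)
  then have cardP: "card P = n" by (simp add: P_def card_image)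
  have cardQ: "card Q = n" by (simp add: Q_def card_image)
  have sizeP: "card X = 2" if "X \<in> P" for X
    using that nofix by (auto simp: P_def)
  have sizeQ: "card X = 1" if "X \<in> Q" for X
    using that by (auto simp: Q_def)
  have fin: "finite P" "finite Q" by (auto simp: P_def Q_def)
  have "card (P \<union> Q) = 2 * n"
    using fin sizeP sizeQ cardP cardQ by (subst card_Un_disjoint) fastforce+
  \<comment> \<open>The forbidden sets are told apart by size: 0, \<open>n\<close> and 3 here,
    against 2 in \<open>P\<close> and 1 in \<open>Q\<close>. As \<open>n \<ge> 4\<close>, the size
    \<open>n\<close> differs from all others.\<close>
  moreover have "card {{}, {1..n}, T} = 3"
  proof -
    have "{1..n} \<noteq> {}" "T \<noteq> {}" "T \<noteq> {1..n}" using T(2) assms(1) by auto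
    then show ?thesis by auto
  qed
  moreover have "{{}, {1..n}, T} \<inter> (P \<union> Q) = {}"
    using sizeP sizeQ T(2) assms(1) by fastforce
  ultimately have cardB: "card B = 2 * n + 3"
    unfolding B_def using fin by (subst card_Un_disjoint) auto
  have BPow: "B \<subseteq> Pow {1..n}"
  proof -
    have "?\<sigma> i \<in> {1..n}" if "i \<in> {1..n}" for i
      using that by (simp only: permutes_in_image[OF perm])
    then have "P \<subseteq> Pow {1..n}" unfolding P_def by blast
    then show ?thesis using T(1) by (auto simp: B_def Q_def)
  qed
  have "wrong_at_2 n S ` three_guess_secrets n S \<subseteq> Pow {1..n} - B"
  proof (intro image_subsetI DiffI)
    fix \<pi> assume s: "\<pi> \<in> three_guess_secrets n S"
    show "wrong_at_2 n S \<pi> \<in> Pow {1..n}" by (auto simp: wrong_at_2_def)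
    have "wrong_at_2 n S \<pi> \<noteq> T"
      using not_cyclic_succ_image[OF s assms(2)] T(3) by metis
    moreover have "wrong_at_2 n S \<pi> \<notin> P"
      using not_cyclic_succ_image[OF s assms(2)] cyclic_succ_pair nofix
      unfolding P_def by (metis (no_types, lifting) imageE)
    moreover have "wrong_at_2 n S \<pi> \<notin> Q"
      using not_cyclic_succ_refl[OF s assms(2)] cyclic_succ_singleton
      unfolding Q_def by (metis (no_types, lifting) imageE)
    ultimately show "wrong_at_2 n S \<pi> \<notin> B"
      using wrong_at_2_nonempty[OF s] wrong_at_2_neq_all[OF s] by (simp add: B_def)
  qed
  then have "card (three_guess_secrets n S) \<le> card (Pow {1..n} - B)"
    by (intro card_inj_on_le[OF inj_on_wrong_at_2]) auto
  also have "\<dots> = 2 ^ n - (2 * n + 3)"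
    using BPow cardB by (subst card_Diff_subset) (auto simp: card_Pow intro: finite_subset)
  finally have le: "card (three_guess_secrets n S) \<le> 2 ^ n - (2 * n + 3)" .
  \<comment> \<open>The subtraction in \<open>le\<close> is on naturals; this bound shows that it
    does not truncate, so the estimate carries over to integers.\<close>
  have "card B \<le> card (Pow {1..n})" using BPow by (intro card_mono) auto
  then have "2 * n + 3 \<le> 2 ^ n" by (simp add: cardB card_Pow)
  with le have "card (three_guess_secrets n S) + (2 * n + 3) \<le> 2 ^ n" by linarith
  then have "int (card (three_guess_secrets n S)) + (2 * int n + 3) \<le> 2 ^ n"
    by (metis (mono_tags, lifting) of_nat_add of_nat_mult of_nat_numeral of_nat_le_iff of_nat_power)
  then show ?thesis by (simp add: three_guess_secrets_def)
qed

end
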